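(* Let either $\theta\in[0,1]$ and $a\ge0$, or $\theta\in[-1,0)$ and $a\in[-\theta,-1/\theta]$. Then, for all $n\ge0$, $$p_n^a(\theta)=\left(\frac{-1}{1+a}\right)^{n+1}\sum_{k=0}^{n+1}\phi_{n+1-k}(\theta)\,\frac{\theta^{k(k-1)/2}}{k!}\,(-a)^k.$$
   Context: For $a\in(-1,\infty)$ and $\theta\in\mathbb R$, let $X_1,X_2,\ldots$ be i.i.d. random variables uniformly distributed on $[-a,1]$. Set $p_0^a(\theta):=1$ and, for $n\ge1$, $$p_n^a(\theta):=\mathbb P(X_2\ge\theta X_1,\,X_3\ge\theta X_2,\,\ldots,\,X_{n+1}\ge\theta X_n).$$ For an integer $\ell\ge1$, an $\ell$-profile is a vector $\mathbf r=(r_1,\ldots,r_\ell)$ of integers $r_i\ge0$ with $\sum_{i=1}^\ell i\,r_i=\ell$. Define $\phi_0(\theta):=1$ and, for $\ell\ge1$, $$\phi_\ell(\theta):=\sum_{\ell\text{-profile }\mathbf r}\binom{\sum_{i=1}^\ell r_i}{r_1,\ldots,r_\ell}\prod_{i=1}^\ell\left[\frac{-\theta^{i(i-1)/2}}{i!}\right]^{r_i},$$ where the sum is over all $\ell$-profiles and $\binom{\sum_i r_i}{r_1,\ldots,r_\ell}=\frac{(\sum_i r_i)!}{\prod_j r_j!}$ is the multinomial coefficient; $0^0=1$. *)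

theory Defs
  imports "HOL-Probability.Probability"
begin

text \<open>The sequence is indexed from 1, as in \<open>X\<^sub>1, X\<^sub>2, \<dots>\<close>; the value \<open>X 0\<close> is irrelevant.\<close>

definition iid_uniform :: "'w measure \<Rightarrow> real \<Rightarrow> (nat \<Rightarrow> 'w \<Rightarrow> real) \<Rightarrow> bool" where
  "iid_uniform M a X \<longleftrightarrow>
     prob_space.indep_vars M (\<lambda>_. borel) X {1..} \<and>
     (\<forall>i\<ge>1. distr M borel (X i) = uniform_measure lborel {-a..1})"

definition persistence_prob :: "'w measure \<Rightarrow> (nat \<Rightarrow> 'w \<Rightarrow> real) \<Rightarrow> real \<Rightarrow> nat \<Rightarrow> real" where
  "persistence_prob M X \<theta> n =
     (if n = 0 then 1
      else measure M {\<omega> \<in> space M. \<forall>i\<in>{1..n}. X (i + 1) \<omega> \<ge> \<theta> * X i \<omega>})"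

definition profiles :: "nat \<Rightarrow> (nat \<Rightarrow> nat) set" where
  "profiles l = {r \<in> {1..l} \<rightarrow>\<^sub>E UNIV. (\<Sum>i=1..l. i * r i) = l}"

text \<open>Finiteness ensures that sums over \<^term>\<open>profiles l\<close> are genuine
  (sums over infinite sets would be 0 by convention).\<close>

lemma finite_profiles: "finite (profiles l)"
proof (rule finite_subset)
  show "profiles l \<subseteq> {1..l} \<rightarrow>\<^sub>E {..l}"
  proof
    fix r assume r: "r \<in> profiles l"
    have "r i \<le> l" if i: "i \<in> {1..l}" for i
    proof -
      have "r i \<le> i * r i" using i by simp
      also have "\<dots> \<le> (\<Sum>j=1..l. j * r j)"
        using i by (intro member_le_sum) auto
      also have "\<dots> = l" using r by (simp add: profiles_def)
      finally show ?thesis .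
    qed
    with r show "r \<in> {1..l} \<rightarrow>\<^sub>E {..l}"
      by (auto simp: profiles_def PiE_def)
  qed
qed (simp add: finite_PiE)

definition multinomial_coeff :: "nat \<Rightarrow> (nat \<Rightarrow> nat) \<Rightarrow> real" where
  "multinomial_coeff l r = fact (\<Sum>i=1..l. r i) / (\<Prod>i=1..l. fact (r i))"

definition \<phi> :: "nat \<Rightarrow> real \<Rightarrow> real" where
  "\<phi> l \<theta> =
     (if l = 0 then 1
      else \<Sum>r\<in>profiles l. multinomial_coeff l r *
             (\<Prod>i=1..l. (- (\<theta> ^ (i * (i - 1) div 2)) / fact i) ^ r i))"

end

theory Submission
  imports Defs
begin

text \<open>
  Let \<open>U\<close> be the uniform distribution on \<open>[-a, 1]\<close> and let
  \<open>(T h) x = E [h Y; Y \<ge> \<theta> x]\<close> for \<open>Y\<close> distributed as \<open>U\<close>. Integrating out the last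
  variable, then the one before it, and so on, writes the persistence probability as the mean of
  \<open>T\<^sup>n 1\<close> under \<open>U\<close> (\<open>nn_integral_PiM_chain\<close>).

  The hypotheses on \<open>a\<close> and \<open>\<theta>\<close> ensure that multiplication by \<open>\<theta>\<close> maps \<open>[-a, 1]\<close> into
  itself, so that the threshold \<open>\<theta> x\<close> for the next variable never leaves \<open>[-a, 1]\<close>. Up to powers
  of \<open>1 + a\<close>, the iterates are then \<open>G\<^sub>n (\<theta> x)\<close>, where \<open>G\<^sub>0 = 1\<close> and \<open>G\<^sub>m\<^sub>+\<^sub>1 x\<close> is the integral
  of \<open>G\<^sub>m (\<theta> y)\<close> over \<open>y \<in> [x, 1]\<close>, and the probability itself is
  \<open>G\<^sub>n\<^sub>+\<^sub>1 (-a) / (1 + a)\<^sup>n\<^sup>+\<^sup>1\<close>.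

  It remains to identify \<open>G\<^sub>m x\<close> with the polynomial
  \<open>(-1)\<^sup>m (\<Sum>k\<le>m. \<phi>\<^sub>m\<^sub>-\<^sub>k * \<theta> ^ (k (k - 1) / 2) * x ^ k / k!)\<close>. This polynomial satisfies
  \<open>G\<^sub>m\<^sub>+\<^sub>1' x = - G\<^sub>m (\<theta> x)\<close> term by term (\<open>DERIV_persistence_poly\<close>), and the boundary condition
  \<open>G\<^sub>m\<^sub>+\<^sub>1 1 = 0\<close> is a recurrence for \<open>\<phi>\<close> (\<open>\<phi>_convolution_eq_0\<close>). The recurrence holds because
  \<open>\<phi>\<close> sums, over all ordered compositions of \<open>l\<close>, the product of the weights of the parts: a
  profile records the multiplicities of the parts, the multinomial coefficient counts their
  orderings, and splitting off one part gives the recurrence.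
\<close>

section \<open>The recurrence for sums over profiles\<close>

text \<open>The summand of a sum over profiles, for arbitrary weights \<open>c i\<close> of a part \<open>i\<close>.\<close>

definition profile_weight :: "(nat \<Rightarrow> real) \<Rightarrow> nat \<Rightarrow> (nat \<Rightarrow> nat) \<Rightarrow> real" where
  "profile_weight c L r = multinomial_coeff L r * (\<Prod>i=1..L. c i ^ r i)"

text \<open>Profiles of \<open>l\<close> written as functions on the index set \<open>{1..L}\<close>. Removing a part \<open>i\<close> from
  a profile of \<open>l\<close> gives a profile of \<open>l - i\<close> still defined on \<open>{1..l}\<close>, whereas the functions in
  \<^term>\<open>profiles (l - i)\<close> are undefined outside \<open>{1..l - i}\<close>; for \<open>l \<le> L\<close> the two encodings give
  the same sums (\<open>sum_wide_profiles\<close> below).\<close>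

definition wide_profiles :: "nat \<Rightarrow> nat \<Rightarrow> (nat \<Rightarrow> nat) set" where
  "wide_profiles L l = {r \<in> {1..L} \<rightarrow>\<^sub>E UNIV. (\<Sum>i=1..L. i * r i) = l}"

lemma wide_profiles_part_le:
  assumes "r \<in> wide_profiles L l" "i \<in> {1..L}"
  shows "i * r i \<le> l"
proof -
  have "i * r i \<le> (\<Sum>j=1..L. j * r j)"
    using assms by (intro member_le_sum) auto
  with assms show ?thesis by (simp add: wide_profiles_def)
qed

lemma wide_profiles_eq_0:
  assumes "r \<in> wide_profiles L l" "i \<in> {1..L}" "l < i"
  shows "r i = 0"
proof (rule ccontr)
  assume "r i \<noteq> 0"
  then have "i \<le> i * r i" by simp
  with wide_profiles_part_le[OF assms(1,2)] assms(3) show False by linarith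
qed

lemma sum_wide_profiles:
  assumes "l \<le> L"
  shows "(\<Sum>r\<in>wide_profiles L l. profile_weight c L r) = (\<Sum>r\<in>profiles l. profile_weight c l r)"
proof -
  have sum_eq: "(\<Sum>i=1..L. f i) = (\<Sum>i=1..l. f i)" if "\<And>i. i \<in> {l+1..L} \<Longrightarrow> f i = 0" for f :: "nat \<Rightarrow> nat"
    using that assms by (intro sum.mono_neutral_right) auto
  have prod_eq: "(\<Prod>i=1..L. f i) = (\<Prod>i=1..l. f i)" if "\<And>i. i \<in> {l+1..L} \<Longrightarrow> f i = 1" for f :: "nat \<Rightarrow> real"
    using that assms by (intro prod.mono_neutral_right) auto
  define ext where "ext r = restrict (\<lambda>i. if i \<le> l then r i else 0 :: nat) {1..L}" for r
  have weight: "profile_weight c L r = profile_weight c l (restrict r {1..l})"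
    if "r \<in> wide_profiles L l" for r
  proof -
    have z: "r i = 0" if "i \<in> {l+1..L}" for i
      using that wide_profiles_eq_0[OF \<open>r \<in> _\<close>, of i] by auto
    show ?thesis
      unfolding profile_weight_def multinomial_coeff_def
      by (subst sum_eq, simp add: z, (subst prod_eq, simp add: z)+) simp
  qed
  show ?thesis
  proof (rule sum.reindex_bij_witness[where i = ext and j = "\<lambda>r. restrict r {1..l}"])
    fix r assume r: "r \<in> wide_profiles L l"
    show "ext (restrict r {1..l}) = r"
    proof
      fix i show "ext (restrict r {1..l}) i = r i"
        using r wide_profiles_eq_0[OF r, of i]
        by (auto simp: ext_def wide_profiles_def restrict_def PiE_def extensional_def)
    qed
    have "(\<Sum>i=1..l. i * r i) = l"
      using r sum_eq[of "\<lambda>i. i * r i"] wide_profiles_eq_0[OF r] by (simp add: wide_profiles_def)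
    then show "restrict r {1..l} \<in> profiles l"
      by (simp add: profiles_def)
    show "profile_weight c l (restrict r {1..l}) = profile_weight c L r"
      using weight[OF r] by simp
  next
    fix r assume r: "r \<in> profiles l"
    show "restrict (ext r) {1..l} = r"
    proof
      fix i show "restrict (ext r) {1..l} i = r i"
        using r assms by (auto simp: ext_def profiles_def restrict_def PiE_def extensional_def)
    qed
    have "(\<Sum>i=1..L. i * ext r i) = (\<Sum>i=1..l. i * ext r i)"
      by (intro sum_eq) (simp add: ext_def)
    also have "\<dots> = (\<Sum>i=1..l. i * r i)"
      using assms by (intro sum.cong) (auto simp: ext_def)
    finally show "ext r \<in> wide_profiles L l"
      using r by (simp add: wide_profiles_def profiles_def ext_def)
  qed
qed

text \<open>The point of the right-hand side is that only the factor \<^term>\<open>r i\<close> depends on \<open>i\<close>, so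
  that summing over \<open>i\<close> is immediate in the next lemma.\<close>

lemma profile_weight_remove_part:
  assumes i: "i \<in> {1..L}" and "r i \<ge> 1"
  shows "c i * profile_weight c L (r(i := r i - 1)) =
    real (r i) * (fact ((\<Sum>j=1..L. r j) - 1) / (\<Prod>j=1..L. fact (r j)) * (\<Prod>j=1..L. c j ^ r j))"
proof -
  let ?s = "r(i := r i - 1)"
  have s: "(\<Sum>j=1..L. ?s j) = (\<Sum>j=1..L. r j) - 1"
    using assms by (simp add: sum.remove[OF _ i] del: One_nat_def)
  have f: "(\<Prod>j=1..L. fact (r j)) = real (r i) * (\<Prod>j=1..L. fact (?s j) :: real)"
    using assms by (simp add: prod.remove[OF _ i] fact_reduce del: One_nat_def)
  have p: "(\<Prod>j=1..L. c j ^ r j) = c i * (\<Prod>j=1..L. c j ^ ?s j)"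
  proof -
    have "c i ^ r i = c i * c i ^ (r i - 1)"
      using assms(2) by (simp flip: power_Suc)
    then show ?thesis
      using assms by (simp add: prod.remove[OF _ i] del: One_nat_def)
  qed
  show ?thesis
    unfolding profile_weight_def multinomial_coeff_def s f p
    using assms(2) by simp
qed

text \<open>Pascal's rule for multinomial coefficients, weighted: classify the orderings of the parts by
  the part that comes first.\<close>

lemma profile_weight_recurrence:
  assumes "(\<Sum>i=1..L. r i) \<ge> 1"
  shows "profile_weight c L r =
    (\<Sum>i=1..L. if r i \<ge> 1 then c i * profile_weight c L (r(i := r i - 1)) else 0)"
proof -
  let ?N = "\<Sum>i=1..L. r i"
  let ?K = "fact (?N - 1) / (\<Prod>j=1..L. fact (r j)) * (\<Prod>j=1..L. c j ^ r j)"
  have "(\<Sum>i=1..L. if r i \<ge> 1 then c i * profile_weight c L (r(i := r i - 1)) else 0)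
      = (\<Sum>i=1..L. real (r i) * ?K)"
  proof (intro sum.cong refl)
    fix i assume "i \<in> {1..L}"
    then show "(if r i \<ge> 1 then c i * profile_weight c L (r(i := r i - 1)) else 0) = real (r i) * ?K"
      using profile_weight_remove_part[of i L r c] by (cases "r i \<ge> 1") auto
  qed
  also have "\<dots> = real ?N * ?K"
    by (simp only: of_nat_sum sum_distrib_right)
  also have "\<dots> = (real ?N * fact (?N - 1)) / (\<Prod>j=1..L. fact (r j)) * (\<Prod>j=1..L. c j ^ r j)"
    by simp
  also have "real ?N * fact (?N - 1) = fact ?N"
    using assms by (intro fact_reduce[symmetric]) linarith
  finally show ?thesis
    by (simp add: profile_weight_def multinomial_coeff_def)
qed

lemma sum_profiles_with_part:
  assumes i: "i \<in> {1..l}"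
  shows "(\<Sum>r | r \<in> profiles l \<and> r i \<ge> 1. profile_weight c l (r(i := r i - 1))) =
    (\<Sum>r\<in>profiles (l - i). profile_weight c (l - i) r)"
proof -
  have up: "(\<Sum>j=1..l. j * (r(i := Suc (r i))) j) = i + (\<Sum>j=1..l. j * r j)" for r
    using i by (simp add: sum.remove[OF _ i] del: One_nat_def)
  have "(\<Sum>r | r \<in> profiles l \<and> r i \<ge> 1. profile_weight c l (r(i := r i - 1))) =
      (\<Sum>r\<in>wide_profiles l (l - i). profile_weight c l r)"
  proof (rule sum.reindex_bij_witness
      [where i = "\<lambda>r. r(i := Suc (r i))" and j = "\<lambda>r. r(i := r i - 1)"])
    fix r assume r: "r \<in> {r. r \<in> profiles l \<and> r i \<ge> 1}"
    let ?s = "r(i := r i - 1)"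
    have restore: "?s(i := Suc (?s i)) = r"
      using r by (auto simp: fun_eq_iff)
    then show "?s(i := Suc (?s i)) = r" .
    have "i + (\<Sum>j=1..l. j * ?s j) = l"
      using up[of ?s] r unfolding restore by (simp add: profiles_def)
    moreover have "?s \<in> {1..l} \<rightarrow>\<^sub>E UNIV"
      using r i by (auto simp: profiles_def PiE_def extensional_def)
    ultimately show "?s \<in> wide_profiles l (l - i)"
      by (simp add: wide_profiles_def)
  next
    fix r assume r: "r \<in> wide_profiles l (l - i)"
    have "(\<Sum>j=1..l. j * (r(i := Suc (r i))) j) = l"
      using up[of r] r i by (simp add: wide_profiles_def)
    moreover have "r(i := Suc (r i)) \<in> {1..l} \<rightarrow>\<^sub>E UNIV"
      using r i by (auto simp: wide_profiles_def PiE_def extensional_def)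
    ultimately show "r(i := Suc (r i)) \<in> {r. r \<in> profiles l \<and> r i \<ge> 1}"
      by (simp add: profiles_def)
  qed auto
  also have "\<dots> = (\<Sum>r\<in>profiles (l - i). profile_weight c (l - i) r)"
    by (rule sum_wide_profiles) simp
  finally show ?thesis .
qed

lemma sum_profiles_recurrence:
  assumes "l \<ge> 1"
  shows "(\<Sum>r\<in>profiles l. profile_weight c l r) =
    (\<Sum>i=1..l. c i * (\<Sum>r\<in>profiles (l - i). profile_weight c (l - i) r))"
proof -
  have pos: "(\<Sum>i=1..l. r i) \<ge> 1" if "r \<in> profiles l" for r
  proof (rule ccontr)
    assume "\<not> ?thesis"
    then have "(\<Sum>i=1..l. r i) = 0" by linarith
    then have "\<forall>i\<in>{1..l}. r i = 0" by simp
    then have "(\<Sum>i=1..l. i * r i) = 0" by simp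
    with that assms show False by (simp add: profiles_def)
  qed
  have "(\<Sum>r\<in>profiles l. profile_weight c l r) =
      (\<Sum>r\<in>profiles l. \<Sum>i=1..l. if r i \<ge> 1 then c i * profile_weight c l (r(i := r i - 1)) else 0)"
    by (intro sum.cong refl profile_weight_recurrence pos)
  also have "\<dots> = (\<Sum>i=1..l. \<Sum>r\<in>profiles l. if r i \<ge> 1 then c i * profile_weight c l (r(i := r i - 1)) else 0)"
    by (rule sum.swap)
  also have "\<dots> = (\<Sum>i=1..l. \<Sum>r | r \<in> profiles l \<and> r i \<ge> 1. c i * profile_weight c l (r(i := r i - 1)))"
    by (intro sum.cong refl sum.inter_filter[symmetric] finite_profiles)
  also have "\<dots> = (\<Sum>i=1..l. c i * (\<Sum>r\<in>profiles (l - i). profile_weight c (l - i) r))"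
    by (intro sum.cong refl) (simp only: sum_profiles_with_part flip: sum_distrib_left)
  finally show ?thesis .
qed

lemma \<phi>_eq_sum_profiles:
  "\<phi> l \<theta> = (\<Sum>r\<in>profiles l. profile_weight (\<lambda>i. - (\<theta> ^ (i * (i - 1) div 2)) / fact i) l r)"
proof (cases "l = 0")
  case True
  have "profiles 0 = {\<lambda>_. undefined}" by (auto simp: profiles_def)
  with True show ?thesis by (simp add: \<phi>_def profile_weight_def multinomial_coeff_def)
qed (simp add: \<phi>_def profile_weight_def)

lemma \<phi>_convolution_eq_0:
  assumes "m \<ge> 1"
  shows "(\<Sum>k=0..m. \<phi> (m - k) \<theta> * (\<theta> ^ (k * (k - 1) div 2) / fact k)) = 0"
proof -
  have "\<phi> m \<theta> = (\<Sum>k=1..m. - (\<theta> ^ (k * (k - 1) div 2)) / fact k * \<phi> (m - k) \<theta>)"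
    unfolding \<phi>_eq_sum_profiles by (rule sum_profiles_recurrence[OF assms])
  also have "\<dots> = - (\<Sum>k=1..m. \<phi> (m - k) \<theta> * (\<theta> ^ (k * (k - 1) div 2) / fact k))"
    by (simp add: sum_negf mult.commute)
  finally show ?thesis
    by (simp add: sum.atLeast_Suc_atMost)
qed

section \<open>The volume polynomials\<close>

text \<open>\<^term>\<open>persistence_poly \<theta> m x\<close> is the volume of the set of \<open>(y\<^sub>1, \<dots>, y\<^sub>m)\<close> in \<open>[-a, 1]\<^sup>m\<close>
  with \<open>y\<^sub>1 \<ge> x\<close> and \<open>y\<^sub>i\<^sub>+\<^sub>1 \<ge> \<theta> y\<^sub>i\<close>, provided \<open>x \<in> [-a, 1]\<close> and multiplication by \<open>\<theta>\<close> preserves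
  \<open>[-a, 1]\<close>. The polynomial itself does not depend on \<open>a\<close>.\<close>

definition persistence_poly :: "real \<Rightarrow> nat \<Rightarrow> real \<Rightarrow> real" where
  "persistence_poly \<theta> m x =
     (-1) ^ m * (\<Sum>k=0..m. \<phi> (m - k) \<theta> * (\<theta> ^ (k * (k - 1) div 2) / fact k) * x ^ k)"

lemma persistence_poly_0 [simp]: "persistence_poly \<theta> 0 x = 1"
  by (simp add: persistence_poly_def \<phi>_def)

lemma persistence_poly_Suc_1: "persistence_poly \<theta> (Suc m) 1 = 0"
  using \<phi>_convolution_eq_0[of "Suc m" \<theta>] by (simp only: persistence_poly_def power_one mult_1_right mult_zero_right)

lemma triangle_Suc: "Suc k * (Suc k - 1) div 2 = k + k * (k - 1) div 2"
proof -
  have "Suc k * (Suc k - 1) = 2 * k + k * (k - 1)"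
    by (cases k) auto
  then show ?thesis by simp
qed

lemma DERIV_persistence_poly:
  "(persistence_poly \<theta> (Suc m) has_real_derivative - persistence_poly \<theta> m (\<theta> * x)) (at x)"
proof -
  let ?c = "\<lambda>k. \<phi> (Suc m - k) \<theta> * (\<theta> ^ (k * (k - 1) div 2) / fact k)"
  have eq: "persistence_poly \<theta> (Suc m) =
      (\<lambda>x. (-1) ^ Suc m * (?c 0 + (\<Sum>k=0..m. ?c (Suc k) * x ^ Suc k)))"
    unfolding persistence_poly_def sum.atLeast0_atMost_Suc_shift by simp
  have pow: "((\<lambda>x. x ^ Suc k) has_real_derivative real (Suc k) * x ^ k) (at x)" for k
    using DERIV_pow[of "Suc k" x] by simp
  have deriv: "(persistence_poly \<theta> (Suc m) has_real_derivative
      (-1) ^ Suc m * (\<Sum>k=0..m. ?c (Suc k) * (real (Suc k) * x ^ k))) (at x)"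
    unfolding eq
    by (rule DERIV_cmult, rule DERIV_cong, rule DERIV_add, rule DERIV_const, rule DERIV_sum,
        rule DERIV_cmult, rule pow) simp
  have coeff: "?c (Suc k) * (real (Suc k) * x ^ k) =
      \<phi> (m - k) \<theta> * (\<theta> ^ (k * (k - 1) div 2) / fact k) * (\<theta> * x) ^ k" for k
    unfolding triangle_Suc fact_Suc power_add power_mult_distrib
    by (simp add: mult_ac del: of_nat_Suc)
  show ?thesis
    using deriv unfolding coeff by (simp add: persistence_poly_def)
qed

lemma measurable_persistence_poly [measurable]:
  "persistence_poly \<theta> m \<in> borel_measurable borel"
  unfolding persistence_poly_def by measurable

lemma persistence_poly_nonneg:
  assumes inv: "(\<lambda>x. \<theta> * x) ` {-a..1} \<subseteq> {-a..1}" and "x \<in> {-a..1}"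
  shows "persistence_poly \<theta> m x \<ge> 0"
  using assms(2)
proof (induction m arbitrary: x)
  case (Suc m)
  have "persistence_poly \<theta> (Suc m) 1 \<le> persistence_poly \<theta> (Suc m) x"
  proof (rule DERIV_nonpos_imp_nonincreasing[where f = "persistence_poly \<theta> (Suc m)"])
    fix y assume "x \<le> y" "y \<le> 1"
    with Suc.prems inv have "persistence_poly \<theta> m (\<theta> * y) \<ge> 0"
      by (intro Suc.IH) (auto simp: image_subset_iff)
    then show "\<exists>d. (persistence_poly \<theta> (Suc m) has_real_derivative d) (at y) \<and> d \<le> 0"
      using DERIV_persistence_poly by fastforce
  qed (use Suc.prems in auto)
  then show ?case by (simp add: persistence_poly_Suc_1)
qed auto

lemma nn_integral_persistence_poly:
  assumes inv: "(\<lambda>x. \<theta> * x) ` {-a..1} \<subseteq> {-a..1}" and x: "x \<in> {-a..1}"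
  shows "(\<integral>\<^sup>+y. ennreal (persistence_poly \<theta> m (\<theta> * y)) * indicator {x..1} y \<partial>lborel)
    = ennreal (persistence_poly \<theta> (Suc m) x)"
proof -
  have "(\<integral>\<^sup>+y. ennreal (persistence_poly \<theta> m (\<theta> * y)) * indicator {x..1} y \<partial>lborel)
      = ennreal (- persistence_poly \<theta> (Suc m) 1 - - persistence_poly \<theta> (Suc m) x)"
  proof (rule nn_integral_FTC_Icc[where F = "\<lambda>x. - persistence_poly \<theta> (Suc m) x"])
    show "(\<lambda>y. persistence_poly \<theta> m (\<theta> * y)) \<in> borel_measurable borel"
      by measurable
    fix y assume y: "y \<in> {x..1}"
    show "((\<lambda>x. - persistence_poly \<theta> (Suc m) x) has_real_derivative
        persistence_poly \<theta> m (\<theta> * y)) (at y)"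
      using DERIV_minus[OF DERIV_persistence_poly] by simp
    show "persistence_poly \<theta> m (\<theta> * y) \<ge> 0"
      using y x inv by (intro persistence_poly_nonneg[OF inv]) (auto simp: image_subset_iff)
  qed (use x in auto)
  then show ?thesis by (simp add: persistence_poly_Suc_1)
qed

section \<open>The transfer operator\<close>

text \<open>One step of the chain, acting on functions of the current state: the next state is drawn from
  \<open>U\<close>, and the chain is killed if it lies below \<open>\<theta> * x\<close>.\<close>

definition transfer :: "real measure \<Rightarrow> real \<Rightarrow> (real \<Rightarrow> ennreal) \<Rightarrow> real \<Rightarrow> ennreal" where
  "transfer U \<theta> h x = (\<integral>\<^sup>+y. indicator {\<theta> * x..} y * h y \<partial>U)"

lemma measurable_transfer:
  assumes "sigma_finite_measure U" and [measurable_cong]: "sets U = sets borel"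
    and [measurable]: "h \<in> borel_measurable borel"
  shows "transfer U \<theta> h \<in> borel_measurable borel"
proof -
  interpret sigma_finite_measure U by fact
  have "(\<lambda>x. \<integral>\<^sup>+y. (if \<theta> * x \<le> y then 1 else 0) * h y \<partial>U) \<in> borel_measurable borel"
    by measurable
  then show ?thesis
    by (simp add: transfer_def[abs_def] indicator_def of_bool_def)
qed

lemma measurable_chain_event:
  fixes U :: "real measure" and n :: nat
  assumes "sets U = sets borel"
  shows "Measurable.pred (\<Pi>\<^sub>M i\<in>{1..n+1}. U) (\<lambda>x. \<forall>i\<in>{1..n}. x (i + 1) \<ge> \<theta> * x i)"
proof (intro pred_intros_finite finite_atLeastAtMost)
  have comp: "(\<lambda>x. x j) \<in> borel_measurable (\<Pi>\<^sub>M i\<in>{1..n+1}. U)" if "j \<in> {1..n+1}" for j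
    using measurable_component_singleton[OF that, of "\<lambda>_. U"]
    by (simp add: measurable_cong_sets[OF refl assms])
  fix i assume i: "i \<in> {1..n}"
  show "Measurable.pred (\<Pi>\<^sub>M i\<in>{1..n+1}. U) (\<lambda>x. x (i + 1) \<ge> \<theta> * x i)"
    unfolding pred_def
    by (intro borel_measurable_le borel_measurable_times borel_measurable_const comp) (use i in auto)
qed

text \<open>Integrating out the last coordinate replaces \<open>h\<close> by its image under the transfer operator; the
  statement is kept general in \<open>h\<close> so that the induction can proceed.\<close>

lemma nn_integral_PiM_chain:
  assumes U: "prob_space U" and sU [measurable_cong]: "sets U = sets borel"
    and "h \<in> borel_measurable borel"
  shows "(\<integral>\<^sup>+x. indicator {x. \<forall>i\<in>{1..n}. x (i + 1) \<ge> \<theta> * x i} x * h (x (n + 1)) \<partial>(\<Pi>\<^sub>M i\<in>{1..n+1}. U))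
    = (\<integral>\<^sup>+y. (transfer U \<theta> ^^ n) h y \<partial>U)"
  using assms(3)
proof (induction n arbitrary: h)
  interpret prob_space U by fact
  interpret product_sigma_finite "\<lambda>_::nat. U"
    by (intro product_sigma_finite.intro sigma_finite_measure_axioms)
  case 0
  have [measurable]: "h \<in> borel_measurable borel" by fact
  have "(\<integral>\<^sup>+x. h (x 1) \<partial>(\<Pi>\<^sub>M i\<in>{1::nat}. U)) = (\<integral>\<^sup>+y. h y \<partial>U)"
    by (rule product_nn_integral_singleton) simp
  then show ?case by simp
next
  interpret prob_space U by fact
  interpret product_sigma_finite "\<lambda>_::nat. U"
    by (intro product_sigma_finite.intro sigma_finite_measure_axioms)
  case (Suc n)
  note [measurable] = Suc.prems
  let ?E = "\<lambda>n. {x::nat \<Rightarrow> real. \<forall>i\<in>{1..n}. x (i + 1) \<ge> \<theta> * x i}"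
  let ?P = "\<lambda>n. \<Pi>\<^sub>M i\<in>{1..n+1}. U"
  have [measurable]: "transfer U \<theta> h \<in> borel_measurable borel"
    by (rule measurable_transfer) (use sU Suc.prems sigma_finite_measure_axioms in auto)
  have ins: "{1..Suc n + 1} = insert (n + 2) {1..n+1}" by auto
  have [measurable]: "(\<lambda>x. h (x (n + 2))) \<in> borel_measurable (?P (Suc n))"
    using measurable_component_singleton[of "n + 2" "{1..Suc n + 1}" "\<lambda>_. U"]
    by (intro measurable_compose[OF _ Suc.prems]) (simp add: measurable_cong_sets[OF refl sU])
  have [measurable]: "Measurable.pred (?P (Suc n)) (\<lambda>x. \<forall>i\<in>{1..Suc n}. x (i + 1) \<ge> \<theta> * x i)"
    by (rule measurable_chain_event) (fact sU)
  have "(\<lambda>x. (if \<forall>i\<in>{1..Suc n}. x (i + 1) \<ge> \<theta> * x i then 1 else 0) * h (x (n + 2)))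
      \<in> borel_measurable (?P (Suc n))"
    by measurable
  then have meas: "(\<lambda>x. indicator (?E (Suc n)) x * h (x (Suc n + 1))) \<in> borel_measurable (?P (Suc n))"
    by (simp add: indicator_def of_bool_def)
  have "(\<integral>\<^sup>+x. indicator (?E (Suc n)) x * h (x (Suc n + 1)) \<partial>?P (Suc n))
      = (\<integral>\<^sup>+x. (\<integral>\<^sup>+y. indicator (?E (Suc n)) (x(n + 2 := y)) * h ((x(n + 2 := y)) (Suc n + 1)) \<partial>U) \<partial>?P n)"
    using meas unfolding ins by (intro product_nn_integral_insert) auto
  also have "\<dots> = (\<integral>\<^sup>+x. indicator (?E n) x * transfer U \<theta> h (x (n + 1)) \<partial>?P n)"
  proof (intro nn_integral_cong)
    fix x :: "nat \<Rightarrow> real"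
    have "indicator (?E (Suc n)) (x(n + 2 := y)) =
        (indicator (?E n) x * indicator {\<theta> * x (n + 1)..} y :: ennreal)" for y
      by (auto simp: indicator_def atLeastAtMostSuc_conv)
    then show "(\<integral>\<^sup>+y. indicator (?E (Suc n)) (x(n + 2 := y)) * h ((x(n + 2 := y)) (Suc n + 1)) \<partial>U)
        = indicator (?E n) x * transfer U \<theta> h (x (n + 1))"
      unfolding transfer_def
      by (subst nn_integral_cmult[symmetric]) (auto simp: mult.assoc)
  qed
  also have "\<dots> = (\<integral>\<^sup>+y. (transfer U \<theta> ^^ n) (transfer U \<theta> h) y \<partial>U)"
    by (rule Suc.IH) measurable
  finally show ?case by (simp add: funpow_swap1)
qed

section \<open>The uniform distribution\<close>

lemma nn_integral_uniform_Icc: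
  assumes "a > -1" and "f \<in> borel_measurable borel"
  shows "(\<integral>\<^sup>+y. f y \<partial>uniform_measure lborel {-a..1}) =
    ennreal (1 / (1 + a)) * (\<integral>\<^sup>+y. f y * indicator {-a..1} y \<partial>lborel)"
proof -
  have "ennreal (1 / (1 + a)) = 1 / ennreal (1 + a)"
    using divide_ennreal[of 1 "1 + a"] assms by simp
  moreover have "emeasure lborel {-a..1} = ennreal (1 + a)"
    using assms by (subst emeasure_lborel_Icc) (auto simp: add.commute)
  ultimately show ?thesis
    using assms by (subst nn_integral_uniform_measure)
      (auto simp: divide_ennreal_def mult.commute)
qed

text \<open>One step of the recursion for the polynomials, with the normalising factor \<open>1 / (1 + a)\<close> of
  the uniform density.\<close>

lemma nn_integral_uniform_tail:
  assumes a: "a > -1" and inv: "(\<lambda>x. \<theta> * x) ` {-a..1} \<subseteq> {-a..1}" and x: "x \<in> {-a..1}"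
    and [measurable]: "h \<in> borel_measurable borel"
    and h: "\<And>y. y \<in> {-a..1} \<Longrightarrow> h y = ennreal ((1 / (1 + a)) ^ n * persistence_poly \<theta> n (\<theta> * y))"
  shows "(\<integral>\<^sup>+y. indicator {x..} y * h y \<partial>uniform_measure lborel {-a..1}) =
    ennreal ((1 / (1 + a)) ^ Suc n * persistence_poly \<theta> (Suc n) x)"
proof -
  let ?q = "(1 / (1 + a)) :: real"
  have q: "?q \<ge> 0" using a by simp
  have nonneg: "persistence_poly \<theta> n (\<theta> * y) \<ge> 0" if "y \<in> {-a..1}" for y
    using inv that by (intro persistence_poly_nonneg[OF inv]) blast
  have "(\<integral>\<^sup>+y. indicator {x..} y * h y \<partial>uniform_measure lborel {-a..1}) =
      ennreal ?q * (\<integral>\<^sup>+y. indicator {x..} y * h y * indicator {-a..1} y \<partial>lborel)"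
    by (intro nn_integral_uniform_Icc a) measurable
  also have "(\<integral>\<^sup>+y. indicator {x..} y * h y * indicator {-a..1} y \<partial>lborel)
      = (\<integral>\<^sup>+y. ennreal (?q ^ n) * (ennreal (persistence_poly \<theta> n (\<theta> * y)) * indicator {x..1} y) \<partial>lborel)"
    using x q h nonneg by (intro nn_integral_cong) (auto simp: indicator_def ennreal_mult)
  also have "\<dots> = ennreal (?q ^ n) * ennreal (persistence_poly \<theta> (Suc n) x)"
    by (subst nn_integral_cmult) (measurable, simp add: nn_integral_persistence_poly[OF inv x])
  finally show ?thesis
    using q persistence_poly_nonneg[OF inv x] by (simp add: mult.assoc flip: ennreal_mult)
qed

lemma measurable_transfer_funpow_uniform:
  assumes "a > -1"
  shows "(transfer (uniform_measure lborel {-a..1}) \<theta> ^^ n) (\<lambda>_. 1) \<in> borel_measurable borel"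
proof -
  interpret U: prob_space "uniform_measure lborel {-a..1}"
    using assms by (intro prob_space_uniform_measure) (auto simp: emeasure_lborel_Icc)
  show ?thesis
    by (induction n) (auto intro!: measurable_transfer U.sigma_finite_measure_axioms)
qed

text \<open>Both the next iterate of the transfer operator and the probability itself are integrals
  over a tail \<open>{x..}\<close>, for \<open>x = \<theta> * y\<close> and for \<open>x = -a\<close> respectively; this lemma serves both.\<close>

lemma nn_integral_tail_transfer_funpow_uniform:
  assumes a: "a > -1" and inv: "(\<lambda>x. \<theta> * x) ` {-a..1} \<subseteq> {-a..1}" and "x \<in> {-a..1}"
  shows "(\<integral>\<^sup>+y. indicator {x..} y * (transfer (uniform_measure lborel {-a..1}) \<theta> ^^ n) (\<lambda>_. 1) y
      \<partial>uniform_measure lborel {-a..1}) =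
    ennreal ((1 / (1 + a)) ^ Suc n * persistence_poly \<theta> (Suc n) x)"
  using assms(3)
proof (induction n arbitrary: x)
  case (0 x)
  show ?case
    using nn_integral_uniform_tail[OF a inv 0, where n = 0 and h = "\<lambda>_. 1"] by simp
next
  case (Suc n x)
  show ?case
  proof (rule nn_integral_uniform_tail[OF a inv Suc.prems measurable_transfer_funpow_uniform[OF a]])
    fix y assume "y \<in> {-a..1}"
    then have "\<theta> * y \<in> {-a..1}" using inv by blast
    from Suc.IH[OF this]
    show "(transfer (uniform_measure lborel {-a..1}) \<theta> ^^ Suc n) (\<lambda>_. 1) y =
        ennreal ((1 / (1 + a)) ^ Suc n * persistence_poly \<theta> (Suc n) (\<theta> * y))"
      unfolding funpow.simps o_apply by (subst transfer_def)
  qed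
qed

section \<open>The persistence probability\<close>

lemma persistence_prob_eq_PiM:
  assumes "prob_space M" and iid: "iid_uniform M a X"
  shows "ennreal (persistence_prob M X \<theta> n) =
    (\<integral>\<^sup>+x. indicator {x. \<forall>i\<in>{1..n}. x (i + 1) \<ge> \<theta> * x i} x
      \<partial>(\<Pi>\<^sub>M i\<in>{1..n+1}. uniform_measure lborel {-a..1}))"
proof -
  interpret prob_space M by fact
  let ?I = "{1..n+1}"
  let ?B = "\<Pi>\<^sub>M i\<in>?I. (borel :: real measure)"
  let ?E = "{x::nat \<Rightarrow> real. \<forall>i\<in>{1..n}. x (i + 1) \<ge> \<theta> * x i}"
  let ?Y = "\<lambda>\<omega>. \<lambda>i\<in>?I. X i \<omega>"
  have "indep_vars (\<lambda>_. borel) X {1..}"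
    using iid by (simp add: iid_uniform_def)
  then have ind: "indep_vars (\<lambda>_. borel) X ?I"
    by (rule indep_vars_subset) auto
  then have rv [measurable]: "\<And>i. i \<in> ?I \<Longrightarrow> X i \<in> borel_measurable M"
    by (auto simp: indep_vars_def)
  have "distr M ?B ?Y = (\<Pi>\<^sub>M i\<in>?I. distr M borel (X i))"
    using indep_vars_iff_distr_eq_PiM'[where I = ?I and X = X and M' = "\<lambda>_. borel"] ind rv by simp
  also have "\<dots> = (\<Pi>\<^sub>M i\<in>?I. uniform_measure lborel {-a..1})"
    using iid by (intro PiM_cong) (auto simp: iid_uniform_def)
  finally have distr: "distr M ?B ?Y = (\<Pi>\<^sub>M i\<in>?I. uniform_measure lborel {-a..1})" .
  have Y: "?Y \<in> measurable M ?B"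
    by (intro measurable_restrict rv)
  have "Measurable.pred ?B (\<lambda>x. \<forall>i\<in>{1..n}. x (i + 1) \<ge> \<theta> * x i)"
    by (rule measurable_chain_event) simp
  then have E: "{x \<in> space ?B. x \<in> ?E} \<in> sets ?B"
    by (simp add: pred_def)
  (* for n = 0 the event on the right is the whole space *)
  have "persistence_prob M X \<theta> n = measure M {\<omega> \<in> space M. \<forall>i\<in>{1..n}. X (i + 1) \<omega> \<ge> \<theta> * X i \<omega>}"
    by (simp add: persistence_prob_def prob_space)
  also have "{\<omega> \<in> space M. \<forall>i\<in>{1..n}. X (i + 1) \<omega> \<ge> \<theta> * X i \<omega>}
      = ?Y -` {x \<in> space ?B. x \<in> ?E} \<inter> space M"
    by (auto simp: space_PiM)
  finally have "ennreal (persistence_prob M X \<theta> n) = emeasure (distr M ?B ?Y) {x \<in> space ?B. x \<in> ?E}"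
    using Y E by (simp add: emeasure_distr emeasure_eq_measure)
  also have "\<dots> = (\<integral>\<^sup>+x. indicator {x \<in> space ?B. x \<in> ?E} x \<partial>distr M ?B ?Y)"
    using E by (subst nn_integral_indicator) auto
  also have "\<dots> = (\<integral>\<^sup>+x. indicator ?E x \<partial>distr M ?B ?Y)"
    by (intro nn_integral_cong) (auto simp: indicator_def)
  finally show ?thesis unfolding distr .
qed

theorem corollary6:
  fixes M :: "'w measure" and X :: "nat \<Rightarrow> 'w \<Rightarrow> real" and a \<theta> :: real and n :: nat
  assumes "prob_space M"
    and "iid_uniform M a X"
    and "(\<theta> \<in> {0..1} \<and> a \<ge> 0) \<or> (\<theta> \<in> {-1..<0} \<and> a \<in> {-\<theta>..-1/\<theta>})"
  shows "persistence_prob M X \<theta> n =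
           (-1 / (1 + a)) ^ (n + 1) *
           (\<Sum>k=0..n+1. \<phi> (n + 1 - k) \<theta> * (\<theta> ^ (k * (k - 1) div 2) / fact k) * (-a) ^ k)"
proof -
  let ?U = "uniform_measure lborel {-a..1}"
  let ?q = "(1 / (1 + a)) :: real"
  have a: "a > -1" using assms(3) by auto
  have q: "?q \<ge> 0" using a by simp
  have inv: "(\<lambda>x. \<theta> * x) ` {-a..1} \<subseteq> {-a..1}"
  proof (rule image_subsetI)
    fix x assume x: "x \<in> {-a..1}"
    show "\<theta> * x \<in> {-a..1}"
      using assms(3)
    proof
      assume "\<theta> \<in> {0..1} \<and> a \<ge> 0"
      moreover from this have "\<theta> * (-a) \<le> \<theta> * x" "\<theta> * x \<le> \<theta> * 1"
        using x by (intro mult_left_mono; simp)+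
      moreover from calculation have "\<theta> * a \<le> 1 * a"
        by (intro mult_right_mono) auto
      ultimately show ?thesis by auto
    next
      assume *: "\<theta> \<in> {-1..<0} \<and> a \<in> {-\<theta>..-1/\<theta>}"
      then have "\<theta> * (-1 / \<theta>) \<le> \<theta> * a"
        by (intro mult_left_mono_neg) auto
      then have "- (\<theta> * a) \<le> 1" using * by simp
      moreover have "\<theta> * 1 \<le> \<theta> * x" "\<theta> * x \<le> \<theta> * (-a)"
        using x * by (intro mult_left_mono_neg; simp)+
      moreover have "-a \<le> \<theta>" using * by auto
      ultimately show ?thesis by (simp only: atLeastAtMost_iff) linarith
    qed
  qed
  interpret U: prob_space ?U
    using a by (intro prob_space_uniform_measure) (auto simp: emeasure_lborel_Icc)
  let ?h = "(transfer ?U \<theta> ^^ n) (\<lambda>_. 1)"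
  have h [measurable]: "?h \<in> borel_measurable borel"
    by (rule measurable_transfer_funpow_uniform[OF a])
  have "ennreal (persistence_prob M X \<theta> n) = (\<integral>\<^sup>+y. ?h y \<partial>?U)"
    using nn_integral_PiM_chain[OF U.prob_space_axioms, where h = "\<lambda>_. 1" and n = n and \<theta> = \<theta>]
    unfolding persistence_prob_eq_PiM[OF assms(1,2)] by simp
  (* the first variable is unconstrained, which is the tail condition at the left end point *)
  also have "\<dots> = (\<integral>\<^sup>+y. indicator {-a..} y * ?h y \<partial>?U)"
    by (intro nn_integral_cong_AE AE_uniform_measureI) auto
  also have "\<dots> = ennreal (?q ^ Suc n * persistence_poly \<theta> (Suc n) (-a))"
    using a by (intro nn_integral_tail_transfer_funpow_uniform inv) auto
  finally have "persistence_prob M X \<theta> n = ?q ^ Suc n * persistence_poly \<theta> (Suc n) (-a)"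
    using q a persistence_poly_nonneg[OF inv, of "-a" "Suc n"]
    by (subst (asm) ennreal_inj) (auto simp: persistence_prob_def intro!: mult_nonneg_nonneg zero_le_power)
  also have "\<dots> = (-1 / (1 + a)) ^ (n + 1) *
      (\<Sum>k=0..n+1. \<phi> (n + 1 - k) \<theta> * (\<theta> ^ (k * (k - 1) div 2) / fact k) * (-a) ^ k)"
  proof -
    have "(-1 / (1 + a)) ^ (n + 1) = ?q ^ Suc n * (-1) ^ Suc n"
      by (subst power_mult_distrib[symmetric]) simp
    then show ?thesis
      by (simp only: persistence_poly_def mult.assoc Suc_eq_plus1)
  qed
  finally show ?thesis .
qed

end
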